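(* Let $N\ge1$ be an integer, $0<p<1$, $\nu=\lceil Np\rceil$ and $h=\nu-Np\in[0,1)$. The upper mode of $\mathrm{Bin}(N,p)$ is $$\lfloor(N+1)p\rfloor=\nu+\lfloor p-h\rfloor=\begin{cases}\nu,&h\le p,\\ \nu-1,&h>p.\end{cases}$$ That is, writing the upper mode as $\nu+r_{\mathrm{mode}}$, one has $r_{\mathrm{mode}}=0$ if $h\le p$ and $r_{\mathrm{mode}}=-1$ if $h>p$. When $h=p$ (equivalently $(N+1)p\in\mathbb Z$), the lower adjacent point $\nu-1$ is also a mode.
   Context: A mode of $\mathrm{Bin}(N,p)$ is an integer $m\in\{0,\dots,N\}$ maximising $b(m;N,p)=\binom Nm p^m(1-p)^{N-m}$; the upper mode is the largest mode. *)

theory Defs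
  imports "HOL-Probability.Probability"
begin

definition is_binomial_mode :: "nat \<Rightarrow> real \<Rightarrow> nat \<Rightarrow> bool" where
  "is_binomial_mode N p m \<longleftrightarrow> is_arg_max (pmf (binomial_pmf N p)) (\<lambda>k. k \<in> {0..N}) m"

lemma is_binomial_mode_iff:
  assumes "0 \<le> p" "p \<le> 1"
  shows "is_binomial_mode N p m \<longleftrightarrow> m \<in> {0..N} \<and>
    (\<forall>k\<in>{0..N}. real (N choose k) * p ^ k * (1 - p) ^ (N - k)
                 \<le> real (N choose m) * p ^ m * (1 - p) ^ (N - m))"
  using assms by (auto simp: is_binomial_mode_def is_arg_max_linorder)

definition upper_binomial_mode :: "nat \<Rightarrow> real \<Rightarrow> nat" where
  "upper_binomial_mode N p = Max {m. is_binomial_mode N p m}"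

text \<open>The set of modes is finite and nonempty, so \<^const>\<open>Max\<close> does return the largest mode.\<close>

lemma finite_binomial_modes: "finite {m. is_binomial_mode N p m}"
  by (rule finite_subset[of _ "{0..N}"]) (auto simp: is_binomial_mode_def is_arg_max_def)

lemma binomial_modes_nonempty: "{m. is_binomial_mode N p m} \<noteq> {}"
proof -
  let ?f = "pmf (binomial_pmf N p)"
  have "Max (?f ` {0..N}) \<in> ?f ` {0..N}"
    by (rule Max_in) auto
  then obtain m where "m \<in> {0..N}" "?f m = Max (?f ` {0..N})"
    by (metis (no_types, lifting) imageE)
  then have "is_binomial_mode N p m"
    by (auto simp: is_binomial_mode_def is_arg_max_linorder)
  then show ?thesis by auto
qed

end

theory Submission
  imports Defs
begin

text \<open>The ratio of consecutive weights of the binomial distribution shows that the weight increases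
  from \<open>k\<close> to \<open>k + 1\<close> exactly when \<open>k + 1 < (N + 1) p\<close>, and stays constant exactly when
  \<open>k + 1 = (N + 1) p\<close>. Hence the last maximum is at the floor of \<open>(N + 1) p = \<nu> + (p - h)\<close>,
  where \<open>p - h\<close> lies strictly between \<open>-1\<close> and \<open>1\<close>.\<close>

text \<open>Absorption turns \<open>Suc k * (N choose Suc k)\<close> into
  \<open>(N - k) * (N choose k)\<close>, and
  \<open>(N - k) * p - (k + 1) * (1 - p) = (N + 1) * p - (k + 1)\<close>. Stated without division,
  so that the sign of the difference can be read off from the first factor on the right.\<close>

lemma pmf_binomial_Suc_diff:
  fixes p :: real
  assumes "0 \<le> p" "p \<le> 1" "k < N"
  shows "real (Suc k) * (1 - p) * (pmf (binomial_pmf N p) (Suc k) - pmf (binomial_pmf N p) k)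
    = ((real N + 1) * p - real (Suc k)) * pmf (binomial_pmf N p) k"
proof -
  have "Suc k * (N choose Suc k) = (N - k) * (N choose k)"
    by (simp only: binomial_absorption binomial_absorb_comp)
  then have choose: "real (Suc k) * real (N choose Suc k) = (real N - real k) * real (N choose k)"
    using \<open>k < N\<close> by (metis less_imp_le of_nat_diff of_nat_mult)
  have pow: "(1 - p) ^ (N - k) = (1 - p) * (1 - p) ^ (N - Suc k)"
    using \<open>k < N\<close> by (metis Suc_diff_Suc power_Suc)
  have "real (Suc k) * (1 - p) * pmf (binomial_pmf N p) (Suc k)
      = (real (Suc k) * real (N choose Suc k)) * (p * p ^ k * ((1 - p) * (1 - p) ^ (N - Suc k)))"
    using assms by (simp add: mult_ac)
  also have "\<dots> = (real N - real k) * p * pmf (binomial_pmf N p) k"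
    unfolding choose using assms by (simp add: pow mult_ac)
  finally show ?thesis
    by (simp add: algebra_simps)
qed

lemma pmf_binomial_le_Suc:
  fixes p :: real
  assumes "0 < p" "p < 1" "k < N" "real (Suc k) \<le> (real N + 1) * p"
  shows "pmf (binomial_pmf N p) k \<le> pmf (binomial_pmf N p) (Suc k)"
proof -
  let ?d = "pmf (binomial_pmf N p) (Suc k) - pmf (binomial_pmf N p) k"
  have "0 \<le> (real (Suc k) * (1 - p)) * ?d"
    using assms by (simp only: pmf_binomial_Suc_diff) simp
  moreover have "0 < real (Suc k) * (1 - p)"
    using assms by simp
  ultimately have "0 \<le> ?d"
    using zero_le_mult_iff[of "real (Suc k) * (1 - p)" ?d] by linarith
  then show ?thesis by simp
qed

lemma pmf_binomial_Suc_less: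
  fixes p :: real
  assumes "0 < p" "p < 1" "k < N" "(real N + 1) * p < real (Suc k)"
  shows "pmf (binomial_pmf N p) (Suc k) < pmf (binomial_pmf N p) k"
proof -
  let ?d = "pmf (binomial_pmf N p) (Suc k) - pmf (binomial_pmf N p) k"
  \<comment> \<open>Since \<open>0 < p < 1\<close> and \<open>k < N\<close>, the weight at
    \<open>k\<close> is positive; this makes the decrease strict, which excludes modes above the
    floor.\<close>
  have "0 < pmf (binomial_pmf N p) k"
    using assms by simp
  then have "(real (Suc k) * (1 - p)) * ?d < 0"
    using assms by (simp only: pmf_binomial_Suc_diff mult_neg_pos less_imp_le diff_less_0_iff_less)
  moreover have "0 < real (Suc k) * (1 - p)"
    using assms by simp
  ultimately have "?d < 0"
    using mult_less_0_iff[of "real (Suc k) * (1 - p)" ?d] by linarith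
  then show ?thesis by simp
qed

lemma pmf_binomial_Suc_eq:
  fixes p :: real
  assumes "0 < p" "p < 1" "k < N" "(real N + 1) * p = real (Suc k)"
  shows "pmf (binomial_pmf N p) (Suc k) = pmf (binomial_pmf N p) k"
  using pmf_binomial_Suc_diff[of p k N] assms by simp

context
  fixes N :: nat and p :: real
  assumes p: "0 < p" "p < 1"
begin

text \<open>The candidate for the upper mode; \<open>nat\<close> loses nothing because
  \<open>(N + 1) * p\<close> is nonnegative.\<close>

private definition M where "M = nat \<lfloor>(real N + 1) * p\<rfloor>"

private lemma M_le: "real M \<le> (real N + 1) * p"
  and M_gt: "(real N + 1) * p < real (Suc M)"
proof -
  have "0 \<le> (real N + 1) * p" using p by simp
  then show "real M \<le> (real N + 1) * p" "(real N + 1) * p < real (Suc M)"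
    unfolding M_def by linarith+
qed

text \<open>Strictness of \<open>p < 1\<close> gives \<open>M < N + 1\<close>, so the candidate lies
  in the range \<open>{0..N}\<close> over which modes are taken.\<close>

private lemma M_le_N: "M \<le> N"
proof -
  note M_le
  also have "(real N + 1) * p < (real N + 1) * 1"
    using p by (intro mult_strict_left_mono) auto
  finally have "real M < real (Suc N)" by simp
  then show ?thesis by simp
qed

text \<open>Downward induction from \<open>M\<close>: each \<open>n < M\<close> satisfies
  \<open>Suc n \<le> M \<le> (N + 1) * p\<close>, so the weight does not drop from \<open>n\<close>
  to \<open>Suc n\<close>.\<close>

private lemma pmf_le_M:
  assumes "k \<le> M"
  shows "pmf (binomial_pmf N p) k \<le> pmf (binomial_pmf N p) M"
  using assms
proof (induction rule: inc_induct)
  case (step n)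
  have "real (Suc n) \<le> real M" using step.hyps by simp
  also note M_le
  finally have "pmf (binomial_pmf N p) n \<le> pmf (binomial_pmf N p) (Suc n)"
    using p step.hyps M_le_N by (intro pmf_binomial_le_Suc) auto
  with step.IH show ?case by simp
qed simp

private lemma pmf_less_M:
  assumes "M < k" "k \<le> N"
  shows "pmf (binomial_pmf N p) k < pmf (binomial_pmf N p) M"
proof -
  have dec: "pmf (binomial_pmf N p) (Suc n) < pmf (binomial_pmf N p) n" if "M \<le> n" "n < N" for n
  proof (rule pmf_binomial_Suc_less)
    have "real (Suc M) \<le> real (Suc n)" using that by simp
    with M_gt show "(real N + 1) * p < real (Suc n)" by linarith
  qed (use p that in auto)
  \<comment> \<open>The induction starts at \<open>Suc M\<close>, because the strict inequality
    fails at \<open>M\<close> itself.\<close>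
  have "Suc M \<le> k" using assms by simp
  then show ?thesis using assms(2)
  proof (induction rule: dec_induct)
    case base
    then show ?case by (intro dec) auto
  next
    case (step n)
    then have "pmf (binomial_pmf N p) (Suc n) < pmf (binomial_pmf N p) n"
      by (intro dec) auto
    with step show ?case by simp
  qed
qed

private lemma mode_M: "is_binomial_mode N p M"
proof -
  have "pmf (binomial_pmf N p) k \<le> pmf (binomial_pmf N p) M" if "k \<le> N" for k
    using pmf_le_M pmf_less_M that by (meson less_imp_le not_less)
  then show ?thesis
    using M_le_N unfolding is_binomial_mode_def is_arg_max_linorder by auto
qed

text \<open>\<open>M\<close> is a mode, and a mode beyond \<open>M\<close> would contradict the
  strict decrease there.\<close>

lemma upper_binomial_mode_eq_floor: "upper_binomial_mode N p = nat \<lfloor>(real N + 1) * p\<rfloor>"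
proof -
  have "m \<le> M" if "is_binomial_mode N p m" for m
  proof (rule ccontr)
    assume "\<not> m \<le> M"
    moreover have "m \<le> N" "pmf (binomial_pmf N p) M \<le> pmf (binomial_pmf N p) m"
      using that M_le_N by (auto simp: is_binomial_mode_def is_arg_max_linorder)
    ultimately show False using pmf_less_M[of m] by simp
  qed
  then have "Max {m. is_binomial_mode N p m} = M"
    using mode_M by (intro Max_eqI finite_binomial_modes) auto
  then show ?thesis
    by (simp add: upper_binomial_mode_def M_def)
qed

text \<open>Here \<open>M = Suc m\<close>, and the weights at \<open>m\<close> and
  \<open>Suc m\<close> agree, so \<open>m\<close> inherits maximality from \<open>M\<close>.\<close>

lemma is_binomial_mode_lower:
  assumes "(real N + 1) * p = real (Suc m)"
  shows "is_binomial_mode N p m"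
proof -
  have "M = Suc m" by (simp add: M_def assms)
  moreover from this have "m < N" using M_le_N by simp
  ultimately show ?thesis
    using mode_M pmf_binomial_Suc_eq[OF p \<open>m < N\<close> assms]
    by (auto simp: is_binomial_mode_def is_arg_max_linorder)
qed

end

theorem proposition6p1:
  fixes N :: nat and p h :: real and \<nu> r_mode :: int
  assumes "N \<ge> 1" and "0 < p" and "p < 1"
    and "\<nu> = \<lceil>real N * p\<rceil>"
    and "h = real_of_int \<nu> - real N * p"
    and "int (upper_binomial_mode N p) = \<nu> + r_mode"
  shows "h \<in> {0..<1}
    \<and> int (upper_binomial_mode N p) = \<lfloor>(real N + 1) * p\<rfloor>
    \<and> \<lfloor>(real N + 1) * p\<rfloor> = \<nu> + \<lfloor>p - h\<rfloor>
    \<and> \<nu> + \<lfloor>p - h\<rfloor> = (if h \<le> p then \<nu> else \<nu> - 1)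
    \<and> (h \<le> p \<longrightarrow> r_mode = 0)
    \<and> (h > p \<longrightarrow> r_mode = -1)
    \<and> (h = p \<longleftrightarrow> (real N + 1) * p \<in> \<int>)
    \<and> (h = p \<longrightarrow> (\<exists>m. int m = \<nu> - 1 \<and> is_binomial_mode N p m))"
proof -
  have h: "0 \<le> h" "h < 1"
    using assms(4,5) by linarith+
  have Np: "(real N + 1) * p = real_of_int \<nu> + (p - h)"
    using assms(5) by (simp add: algebra_simps)
  have mode: "int (upper_binomial_mode N p) = \<lfloor>(real N + 1) * p\<rfloor>"
    using assms(2,3) by (simp add: upper_binomial_mode_eq_floor)
  have floor: "\<lfloor>(real N + 1) * p\<rfloor> = \<nu> + \<lfloor>p - h\<rfloor>"
    unfolding Np by simp
  have cases: "\<lfloor>p - h\<rfloor> = (if h \<le> p then 0 else -1)"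
    using h assms(2,3) by (auto simp: floor_eq_iff)
  have Ints: "h = p \<longleftrightarrow> (real N + 1) * p \<in> \<int>"
  proof
    assume "(real N + 1) * p \<in> \<int>"
    then obtain i where "real_of_int \<nu> + (p - h) = real_of_int i"
      unfolding Np by (elim Ints_cases)
    then have "p - h = real_of_int (i - \<nu>)" by simp
    \<comment> \<open>An integer strictly between -1 and 1 is zero.\<close>
    moreover from this have "i - \<nu> = 0" using h assms(2,3) by linarith
    ultimately show "h = p" by simp
  qed (simp add: Np)
  have lower: "\<exists>m. int m = \<nu> - 1 \<and> is_binomial_mode N p m" if "h = p"
  proof -
    \<comment> \<open>Positivity of \<open>N * p\<close> gives \<open>\<nu> \<ge> 1\<close>, so that
      \<open>\<nu> - 1\<close> is a natural number and can serve as the witness.\<close>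
    have "0 < real N * p" using assms(1,2) by simp
    then have "1 \<le> \<nu>" using assms(4) by linarith
    then have "int (nat (\<nu> - 1)) = \<nu> - 1" "real (Suc (nat (\<nu> - 1))) = real_of_int \<nu>"
      by simp_all
    then show ?thesis
      using is_binomial_mode_lower[of p N "nat (\<nu> - 1)"] assms(2,3) Np that
      by (intro exI[of _ "nat (\<nu> - 1)"]) simp
  qed
  show ?thesis
    using h mode floor cases Ints lower assms(6) by auto
qed

end
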